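(* Let $q$ be a positive integer and let $\pi$ be a permutation of the set $\{\lceil q/2\rceil,\lceil q/2\rceil+1,\ldots,q\}$. Then there is a well-covered graph $G$ with $\alpha(G)=q$ such that \[ i_{\pi(\lceil q/2\rceil)}(G)<i_{\pi(\lceil q/2\rceil+1)}(G)<\cdots<i_{\pi(q)}(G). \]
   Context: All graphs are finite and simple. For a graph $G$, $i_k(G)$ denotes the number of independent sets of cardinality $k$ in $G$, and $\alpha(G)$ is the independence number (the largest $k$ with $i_k(G)>0$). A graph is well-covered if every maximal independent set has the same cardinality. *)

theory Defs
  imports Complex_Main "HOL-Library.Ramsey" "HOL-Combinatorics.Permutations"
begin

text \<open>Independence is \<^const>\<open>indep\<close> from the Ramsey library, applied to
  the candidate vertex set; \<open>[V]\<^bsup>k\<^esup>\<close> (\<^const>\<open>nsets\<close>) is the set of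
  \<open>k\<close>-element subsets of \<open>V\<close>.\<close>

definition finite_simple_graph :: "'a set \<Rightarrow> 'a set set \<Rightarrow> bool" where
  "finite_simple_graph V E \<longleftrightarrow> finite V \<and> E \<subseteq> [V]\<^bsup>2\<^esup>"

definition num_indep_sets :: "'a set \<Rightarrow> 'a set set \<Rightarrow> nat \<Rightarrow> nat" where
  "num_indep_sets V E k = card {S \<in> [V]\<^bsup>k\<^esup>. indep S E}"

text \<open>For finite \<open>V\<close> the set below is finite and contains \<open>0\<close>, so the
  maximum is meaningful.\<close>

definition independence_number :: "'a set \<Rightarrow> 'a set set \<Rightarrow> nat" where
  "independence_number V E = Max {k. num_indep_sets V E k > 0}"

definition maximal_indep :: "'a set \<Rightarrow> 'a set set \<Rightarrow> 'a set \<Rightarrow> bool" where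
  "maximal_indep V E S \<longleftrightarrow>
     S \<subseteq> V \<and> indep S E \<and> (\<forall>T. T \<subseteq> V \<and> indep T E \<and> S \<subseteq> T \<longrightarrow> T = S)"

definition well_covered :: "'a set \<Rightarrow> 'a set set \<Rightarrow> bool" where
  "well_covered V E \<longleftrightarrow>
     (\<forall>S T. maximal_indep V E S \<and> maximal_indep V E T \<longrightarrow> card S = card T)"

end

theory Submission
  imports Defs
begin

text \<open>Fix \<open>k < q\<close> and let the vertices be the pairs \<open>(i, f)\<close> where \<open>i < q\<close> and \<open>f\<close> assigns a
  colour below \<open>m\<close> to every \<open>k\<close>-subset of \<open>{..<q}\<close> that avoids \<open>i\<close>; join two vertices unless
  their indices differ and their colourings agree on the common domain. Pairwise agreeing
  functions glue, so an independent set of size \<open>j > 0\<close> amounts to a \<open>j\<close>-subset \<open>T\<close> of \<open>{..<q}\<close>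
  with a colouring of the \<open>k\<close>-subsets not containing \<open>T\<close>. The graph is therefore well-covered,
  and \<open>i\<^sub>j\<close> equals \<open>(q choose j) * m ^ (q choose k)\<close> for \<open>j > k\<close>, but is smaller than that by a
  factor of at least \<open>m\<close> for \<open>j \<le> k\<close>. Joins of well-covered graphs with the same independence
  number add the \<open>i\<^sub>j\<close>, so up to scaling and a small error every sequence \<open>(q choose j) * B j\<close>
  with \<open>B\<close> nondecreasing occurs. Since \<open>q choose j\<close> is strictly decreasing for \<open>j \<ge> q / 2\<close>, \<open>B\<close>
  can be chosen such that these products are nearly equal and ordered as desired.\<close>

section \<open>Purity of independent sets\<close>

text \<open>For finite \<open>V\<close> this amounts to being well-covered with independence number
  \<open>q\<close>; the case \<open>S = {}\<close> supplies an independent set of size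
  \<open>q\<close>.\<close>

definition pure_indep :: "'a set \<Rightarrow> 'a set set \<Rightarrow> nat \<Rightarrow> bool" where
  "pure_indep V E q \<longleftrightarrow>
     (\<forall>S \<subseteq> V. indep S E \<longrightarrow> (\<exists>T. S \<subseteq> T \<and> T \<subseteq> V \<and> indep T E \<and> card T = q))"

lemma well_covered_if_pure:
  assumes "pure_indep V E q"
  shows "well_covered V E"
proof -
  have "card S = q" if "maximal_indep V E S" for S
    using that assms unfolding maximal_indep_def pure_indep_def by metis
  then show ?thesis
    unfolding well_covered_def by simp
qed

lemma independence_number_if_pure:
  assumes "finite V" and "pure_indep V E q"
  shows "independence_number V E = q"
proof -
  have pos_iff: "num_indep_sets V E k > 0 \<longleftrightarrow> (\<exists>S \<subseteq> V. card S = k \<and> indep S E)" for k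
  proof -
    have "finite {S \<in> [V]\<^bsup>k\<^esup>. indep S E}"
      using finite_imp_finite_nsets[OF \<open>finite V\<close>] by simp
    then have "num_indep_sets V E k > 0 \<longleftrightarrow> (\<exists>S \<in> [V]\<^bsup>k\<^esup>. indep S E)"
      unfolding num_indep_sets_def by (auto simp: card_gt_0_iff)
    also have "\<dots> \<longleftrightarrow> (\<exists>S \<subseteq> V. card S = k \<and> indep S E)"
      using finite_subset[OF _ \<open>finite V\<close>] by (auto simp: nsets_def)
    finally show ?thesis .
  qed
  have le: "k \<le> q" if "num_indep_sets V E k > 0" for k
  proof -
    from that obtain S where S: "S \<subseteq> V" "card S = k" "indep S E"
      using pos_iff by blast
    then obtain T where "S \<subseteq> T" "T \<subseteq> V" "card T = q"
      using assms(2) unfolding pure_indep_def by blast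
    then show ?thesis
      using S card_mono[of T S] finite_subset[OF _ \<open>finite V\<close>] by auto
  qed
  have "indep {} E"
    by (simp add: indep_def)
  then obtain T where "T \<subseteq> V" "indep T E" "card T = q"
    using assms(2) unfolding pure_indep_def by blast
  then have "num_indep_sets V E q > 0"
    using pos_iff by blast
  moreover have "finite {k. num_indep_sets V E k > 0}"
    by (rule finite_subset[of _ "{..q}"]) (use le in blast, simp)
  ultimately show ?thesis
    unfolding independence_number_def by (intro Max_eqI) (use le in blast)+
qed

section \<open>Isomorphic copies on the natural numbers\<close>

lemma indep_image_iff:
  assumes "inj_on f V" and "E \<subseteq> Pow V" and "S \<subseteq> V"
  shows "indep (f ` S) ((`) f ` E) \<longleftrightarrow> indep S E"
proof -
  have "{f u, f v} \<in> (`) f ` E \<longleftrightarrow> {u, v} \<in> E" if "u \<in> S" "v \<in> S" for u v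
  proof -
    have "inj_on ((`) f) (Pow V)"
      using assms(1) by (rule inj_on_image_Pow)
    moreover have "{u, v} \<in> Pow V"
      using that assms(3) by auto
    ultimately have "f ` {u, v} \<in> (`) f ` E \<longleftrightarrow> {u, v} \<in> E"
      using assms(2) by (rule inj_on_image_mem_iff)
    then show ?thesis
      by simp
  qed
  moreover have "f u = f v \<longleftrightarrow> u = v" if "u \<in> S" "v \<in> S" for u v
    using that assms by (meson inj_onD subsetD)
  ultimately show ?thesis
    unfolding indep_def by simp
qed

text \<open>The vertices constructed below contain functions, whereas the theorem asks for vertices
  in \<open>nat\<close>; purity and the counts are invariant under isomorphism.\<close>

lemma isomorphic_graph_on_nat:
  fixes V :: "'a set"
  assumes "finite_simple_graph V E" and "pure_indep V E q"
  obtains V' :: "nat set" and E' where "finite_simple_graph V' E'" "pure_indep V' E' q"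
    "\<And>k. num_indep_sets V' E' k = num_indep_sets V E k"
proof -
  have "finite V" and E: "E \<subseteq> [V]\<^bsup>2\<^esup>"
    using assms(1) by (auto simp: finite_simple_graph_def)
  obtain f :: "'a \<Rightarrow> nat" where inj: "inj_on f V"
    using finite_imp_inj_to_nat_seg[OF \<open>finite V\<close>] by blast
  define E' where "E' = (`) f ` E"
  have "E \<subseteq> Pow V"
    using E by (auto simp: nsets_def)
  note indep_iff = indep_image_iff[OF inj this, folded E'_def]
  have card_eq: "card (f ` S) = card S" if "S \<subseteq> V" for S
    using that inj by (meson card_image inj_on_subset)
  have "E' \<subseteq> [f ` V]\<^bsup>2\<^esup>"
  proof
    fix e assume "e \<in> E'"
    then obtain d where "d \<in> [V]\<^bsup>2\<^esup>" "e = f ` d"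
      using E unfolding E'_def by blast
    then show "e \<in> [f ` V]\<^bsup>2\<^esup>"
      using card_eq[of d] by (simp add: nsets_def image_mono)
  qed
  then have "finite_simple_graph (f ` V) E'"
    using \<open>finite V\<close> by (simp add: finite_simple_graph_def)
  moreover have "pure_indep (f ` V) E' q"
    unfolding pure_indep_def
  proof (intro allI impI)
    fix S' assume "S' \<subseteq> f ` V" "indep S' E'"
    then obtain S where "S \<subseteq> V" "S' = f ` S" "indep S E"
      using indep_iff by (metis subset_image_iff)
    then obtain T where "S \<subseteq> T" "T \<subseteq> V" "indep T E" "card T = q"
      using assms(2) unfolding pure_indep_def by blast
    then show "\<exists>T'. S' \<subseteq> T' \<and> T' \<subseteq> f ` V \<and> indep T' E' \<and> card T' = q"
      using indep_iff card_eq \<open>S' = f ` S\<close> by (intro exI[of _ "f ` T"]) auto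
  qed
  moreover have "num_indep_sets (f ` V) E' k = num_indep_sets V E k" for k
  proof -
    have "{S' \<in> [f ` V]\<^bsup>k\<^esup>. indep S' E'} = (`) f ` {S \<in> [V]\<^bsup>k\<^esup>. indep S E}"
    proof (intro equalityI subsetI)
      fix S' assume S': "S' \<in> {S' \<in> [f ` V]\<^bsup>k\<^esup>. indep S' E'}"
      then obtain S where "S \<subseteq> V" "S' = f ` S"
        by (auto simp: nsets_def subset_image_iff)
      then show "S' \<in> (`) f ` {S \<in> [V]\<^bsup>k\<^esup>. indep S E}"
        using S' indep_iff card_eq finite_subset[OF _ \<open>finite V\<close>] by (auto simp: nsets_def)
    next
      fix S' assume "S' \<in> (`) f ` {S \<in> [V]\<^bsup>k\<^esup>. indep S E}"
      then show "S' \<in> {S' \<in> [f ` V]\<^bsup>k\<^esup>. indep S' E'}"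
        using indep_iff card_eq by (auto simp: nsets_def)
    qed
    moreover have "inj_on ((`) f) {S \<in> [V]\<^bsup>k\<^esup>. indep S E}"
      by (rule inj_on_subset[OF inj_on_image_Pow[OF inj]]) (auto simp: nsets_def)
    ultimately show ?thesis
      unfolding num_indep_sets_def by (simp add: card_image)
  qed
  ultimately show thesis
    using that by blast
qed

section \<open>Independent sets of the gluing graph\<close>

text \<open>The graph is the join of one component for each \<open>c \<in> C\<close>; the colourings in component \<open>c\<close> are
  defined on members of \<open>K c\<close>, an arbitrary family of sets.\<close>

locale gluing_graph =
  fixes q m :: nat and C :: "'c set" and K :: "'c \<Rightarrow> nat set set"
  assumes fin_C: "finite C" and C_nonempty: "C \<noteq> {}"
    and fin_K: "\<And>c. c \<in> C \<Longrightarrow> finite (K c)" and m_pos: "m > 0"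
begin

definition vertices :: "('c \<times> nat \<times> (nat set \<Rightarrow> nat)) set" where
  "vertices = (SIGMA c:C. SIGMA i:{..<q}. {A \<in> K c. i \<notin> A} \<rightarrow>\<^sub>E {..<m})"

text \<open>Non-adjacency of distinct vertices. Requiring \<open>c = d\<close> joins different
  components completely; requiring \<open>i \<noteq> j\<close> makes the vertices of a given index a
  clique.\<close>

fun compat :: "'c \<times> nat \<times> (nat set \<Rightarrow> nat) \<Rightarrow> 'c \<times> nat \<times> (nat set \<Rightarrow> nat) \<Rightarrow> bool" where
  "compat (c, i, f) (d, j, g) \<longleftrightarrow>
     c = d \<and> i \<noteq> j \<and> (\<forall>A \<in> K c. i \<notin> A \<longrightarrow> j \<notin> A \<longrightarrow> f A = g A)"

definition edges :: "('c \<times> nat \<times> (nat set \<Rightarrow> nat)) set set" where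
  "edges = {{u, v} | u v. u \<in> vertices \<and> v \<in> vertices \<and> u \<noteq> v \<and> \<not> compat u v}"

text \<open>\<open>A\<close> lies in the domain of the colouring at some index of \<open>T\<close>
  exactly when \<open>\<not> T \<subseteq> A\<close>, so these are the functions obtained by gluing
  over \<open>T\<close>.\<close>

definition partial_sections :: "'c \<Rightarrow> nat set \<Rightarrow> (nat set \<Rightarrow> nat) set" where
  "partial_sections c T = {A \<in> K c. \<not> T \<subseteq> A} \<rightarrow>\<^sub>E {..<m}"

definition face :: "'c \<Rightarrow> nat set \<Rightarrow> (nat set \<Rightarrow> nat) \<Rightarrow> ('c \<times> nat \<times> (nat set \<Rightarrow> nat)) set" where
  "face c T F = (\<lambda>i. (c, i, restrict F {A \<in> K c. i \<notin> A})) ` T"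

lemma compat_sym: "compat u v \<Longrightarrow> compat v u"
  by (cases u; cases v) auto

lemma finite_vertices: "finite vertices"
  unfolding vertices_def using fin_C fin_K by (intro finite_SigmaI finite_PiE) auto

lemma finite_simple_graph: "finite_simple_graph vertices edges"
  unfolding finite_simple_graph_def edges_def nsets_def using finite_vertices by auto

lemma indep_iff:
  assumes "S \<subseteq> vertices"
  shows "indep S edges \<longleftrightarrow> (\<forall>u\<in>S. \<forall>v\<in>S. u \<noteq> v \<longrightarrow> compat u v)"
proof -
  have "{u, v} \<in> edges \<longleftrightarrow> \<not> compat u v" if "u \<in> S" "v \<in> S" "u \<noteq> v" for u v
  proof
    assume "{u, v} \<in> edges"
    then obtain x y where "{u, v} = {x, y}" "\<not> compat x y"
      unfolding edges_def by blast
    then show "\<not> compat u v"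
      using compat_sym[of u v] by (auto simp only: doubleton_eq_iff)
  next
    assume "\<not> compat u v"
    moreover have "u \<in> vertices" "v \<in> vertices"
      using that assms by blast+
    ultimately show "{u, v} \<in> edges"
      unfolding edges_def using \<open>u \<noteq> v\<close>
      by (intro CollectI exI[of _ u] exI[of _ v] conjI) simp_all
  qed
  then show ?thesis
    unfolding indep_def by blast
qed

lemma face_subset:
  assumes "c \<in> C" "T \<subseteq> {..<q}" "F \<in> partial_sections c T"
  shows "face c T F \<subseteq> vertices"
proof -
  have "restrict F {A \<in> K c. i \<notin> A} \<in> {A \<in> K c. i \<notin> A} \<rightarrow>\<^sub>E {..<m}" if "i \<in> T" for i
  proof (rule restrict_PiE_iff[THEN iffD2], rule ballI)
    fix A assume "A \<in> {A \<in> K c. i \<notin> A}"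
    then have "A \<in> {A \<in> K c. \<not> T \<subseteq> A}"
      using that by blast
    then show "F A \<in> {..<m}"
      using assms(3) unfolding partial_sections_def by (rule PiE_mem[rotated])
  qed
  then show ?thesis
    using assms(1,2) unfolding face_def vertices_def by blast
qed

lemma indep_face:
  assumes "c \<in> C" "T \<subseteq> {..<q}" "F \<in> partial_sections c T"
  shows "indep (face c T F) edges"
  unfolding indep_iff[OF face_subset[OF assms]] by (auto simp: face_def)

lemma card_face: "card (face c T F) = card T"
  unfolding face_def by (intro card_image) (simp add: inj_on_def)

text \<open>Compatibility forces a single component and one colouring per index; the colourings
  agree wherever their domains meet and hence glue.\<close>

lemma indep_imp_face:
  assumes "S \<subseteq> vertices" "indep S edges" "S \<noteq> {}"
  obtains c T F where "c \<in> C" "T \<subseteq> {..<q}" "F \<in> partial_sections c T" "S = face c T F"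
proof -
  have compat: "compat u v" if "u \<in> S" "v \<in> S" "u \<noteq> v" for u v
    using assms that indep_iff by blast
  obtain c i0 f0 where u0: "(c, i0, f0) \<in> S"
    using \<open>S \<noteq> {}\<close> by (metis prod_cases3 ex_in_conv)
  have same: "d = c" if "(d, i, f) \<in> S" for d i f
    using compat[OF that u0] by auto
  define T where "T = {i. \<exists>f. (c, i, f) \<in> S}"
  define fs where "fs i = (SOME f. (c, i, f) \<in> S)" for i
  have fs: "(c, i, fs i) \<in> S" if "i \<in> T" for i
    using that unfolding T_def fs_def mem_Collect_eq by (rule someI_ex)
  have fs_eq: "f = fs i" if "(c, i, f) \<in> S" for i f
    using compat[OF that fs] that by (auto simp: T_def)
  have S: "S = (\<lambda>i. (c, i, fs i)) ` T"
  proof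
    show "S \<subseteq> (\<lambda>i. (c, i, fs i)) ` T"
    proof
      fix u assume "u \<in> S"
      moreover obtain d i f where "u = (d, i, f)"
        by (rule prod_cases3)
      ultimately have "(c, i, f) \<in> S" "u = (c, i, f)"
        using same by auto
      moreover from this have "i \<in> T" "f = fs i"
        using fs_eq unfolding T_def by blast+
      ultimately show "u \<in> (\<lambda>i. (c, i, fs i)) ` T"
        by blast
    qed
  qed (use fs in blast)
  have T: "c \<in> C" "T \<subseteq> {..<q}"
    using u0 fs assms(1) by (auto simp: vertices_def)
  have fs_PiE: "fs i \<in> {A \<in> K c. i \<notin> A} \<rightarrow>\<^sub>E {..<m}" if "i \<in> T" for i
    using fs[OF that] assms(1) by (auto simp: vertices_def)
  \<comment> \<open>Every index of \<open>T\<close> outside \<open>A\<close> gives the same value,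
    so the choice made by \<open>SOME\<close> is immaterial.\<close>
  define F where "F = (\<lambda>A \<in> {A \<in> K c. \<not> T \<subseteq> A}. fs (SOME i. i \<in> T \<and> i \<notin> A) A)"
  have F_eq: "F A = fs i A" if "A \<in> K c" "i \<in> T" "i \<notin> A" for A i
  proof -
    define j where "j = (SOME i. i \<in> T \<and> i \<notin> A)"
    have j: "j \<in> T \<and> j \<notin> A"
      unfolding j_def by (rule someI[of _ i]) (use that in simp)
    have "fs j A = fs i A"
      using compat[OF fs fs, of i j] that j by (cases "i = j") auto
    then show ?thesis
      using that unfolding F_def j_def by auto
  qed
  have "F \<in> partial_sections c T"
    unfolding partial_sections_def
  proof (rule PiE_I)
    fix A assume "A \<in> {A \<in> K c. \<not> T \<subseteq> A}"
    then obtain i where i: "A \<in> K c" "i \<in> T" "i \<notin> A"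
      by blast
    then show "F A \<in> {..<m}"
      using F_eq fs_PiE by (force simp: PiE_iff)
  qed (auto simp: F_def)
  moreover have "restrict F {A \<in> K c. i \<notin> A} = fs i" if "i \<in> T" for i
    by (rule PiE_ext[of _ "{A \<in> K c. i \<notin> A}" "\<lambda>_. UNIV"])
       (use fs_PiE[OF that] F_eq that in \<open>auto simp: PiE_iff\<close>)
  then have "S = face c T F"
    unfolding S face_def by simp
  ultimately show thesis
    using that T by blast
qed

text \<open>The sets still to be coloured contain \<open>T\<close>, hence every index in
  \<open>T\<close>, so giving them the colour 0 leaves the existing vertices unchanged.\<close>

lemma face_extends:
  assumes "c \<in> C" "T \<subseteq> {..<q}" "F \<in> partial_sections c T"
  obtains F' where "F' \<in> partial_sections c {..<q}" "face c T F \<subseteq> face c {..<q} F'"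
proof -
  define F' where "F' = (\<lambda>A \<in> {A \<in> K c. \<not> {..<q} \<subseteq> A}. if T \<subseteq> A then 0 else F A)"
  have "F' \<in> partial_sections c {..<q}"
    using assms m_pos unfolding F'_def partial_sections_def by (auto simp: PiE_iff)
  moreover have "restrict F {A \<in> K c. i \<notin> A} = restrict F' {A \<in> K c. i \<notin> A}" if "i \<in> T" for i
    using that assms(2) unfolding F'_def by (intro restrict_ext) auto
  then have "face c T F \<subseteq> face c {..<q} F'"
    unfolding face_def using assms(2) by auto
  ultimately show thesis
    using that by blast
qed

lemma pure_indep: "pure_indep vertices edges q"
  unfolding pure_indep_def
proof (intro allI impI)
  fix S assume S: "S \<subseteq> vertices" "indep S edges"
  obtain c T F where cTF: "c \<in> C" "T \<subseteq> {..<q}" "F \<in> partial_sections c T" "S = face c T F"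
  proof (cases "S = {}")
    case True
    obtain c where "c \<in> C"
      using C_nonempty by blast
    moreover have "(\<lambda>_. undefined) \<in> partial_sections c {}"
      by (simp add: partial_sections_def)
    ultimately show ?thesis
      using that True by (auto simp: face_def)
  next
    case False
    show ?thesis
      by (rule indep_imp_face[OF S False]) (rule that)
  qed
  then obtain F' where "F' \<in> partial_sections c {..<q}" "S \<subseteq> face c {..<q} F'"
    using face_extends[OF cTF(1-3)] by blast
  then show "\<exists>T. S \<subseteq> T \<and> T \<subseteq> vertices \<and> indep T edges \<and> card T = q"
    using cTF(1) by (intro exI[of _ "face c {..<q} F'"])
      (auto simp: card_face intro: face_subset[THEN subsetD] indep_face)
qed

text \<open>Component and indices are read off the vertices, and \<open>F A\<close> from the vertex
  at any index in \<open>T\<close> outside \<open>A\<close>. An empty face does not determine its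
  component.\<close>

lemma face_inject:
  assumes "face c T F = face d U G" "T \<noteq> {}"
    "F \<in> partial_sections c T" "G \<in> partial_sections d U"
  shows "c = d \<and> T = U \<and> F = G"
proof -
  have fst: "fst ` face c T F = (\<lambda>_. c) ` T" "(fst \<circ> snd) ` face c T F = T" for c T F
    by (simp_all add: face_def image_image)
  have "T = U"
    using fst(2) assms(1) by metis
  moreover have "c = d"
    using fst(1) assms(1,2) \<open>T = U\<close> by (metis image_constant_conv singleton_inject)
  moreover have "F A = G A" if A: "A \<in> K c" "\<not> T \<subseteq> A" for A
  proof -
    from A obtain i where i: "i \<in> T" "i \<notin> A"
      by blast
    then have "(c, i, restrict F {A \<in> K c. i \<notin> A}) \<in> face d U G"
      using assms(1) unfolding face_def by blast
    then have "restrict F {A \<in> K c. i \<notin> A} = restrict G {A \<in> K c. i \<notin> A}"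
      using \<open>c = d\<close> unfolding face_def by auto
    then show ?thesis
      using A i by (metis (mono_tags, lifting) mem_Collect_eq restrict_apply')
  qed
  ultimately show ?thesis
    using assms(3,4) unfolding partial_sections_def by (auto intro: PiE_ext)
qed

text \<open>\<open>face\<close> is a bijection from the triples of component, index set of size
  \<open>j\<close> and partial section onto the independent \<open>j\<close>-sets.\<close>

lemma num_indep_sets_eq:
  assumes "j > 0"
  shows "num_indep_sets vertices edges j =
    (\<Sum>c\<in>C. \<Sum>T\<in>[{..<q}]\<^bsup>j\<^esup>. m ^ card {A \<in> K c. \<not> T \<subseteq> A})"
proof -
  let ?I = "SIGMA c:C. SIGMA T:[{..<q}]\<^bsup>j\<^esup>. partial_sections c T"
  let ?face = "\<lambda>(c, T, F). face c T F"
  have ne: "T \<noteq> {}" if "T \<in> [{..<q}]\<^bsup>j\<^esup>" for T :: "nat set"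
    using that assms by (auto simp: nsets_def)
  have inj: "inj_on ?face ?I"
  proof (rule inj_onI)
    fix x y assume xy: "x \<in> ?I" "y \<in> ?I" "?face x = ?face y"
    obtain c T F d U G where "x = (c, T, F)" "y = (d, U, G)"
      by (metis prod_cases3)
    then show "x = y"
      using xy face_inject[of c T F d U G] ne[of T] by simp
  qed
  have image: "?face ` ?I = {S \<in> [vertices]\<^bsup>j\<^esup>. indep S edges}"
  proof (intro equalityI subsetI)
    fix S assume "S \<in> ?face ` ?I"
    then obtain c T F where "c \<in> C" "T \<in> [{..<q}]\<^bsup>j\<^esup>" "F \<in> partial_sections c T" "S = face c T F"
      by auto
    then show "S \<in> {S \<in> [vertices]\<^bsup>j\<^esup>. indep S edges}"
      using indep_face face_subset card_face finite_subset[OF _ finite_vertices]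
      by (simp add: nsets_def)
  next
    fix S assume S: "S \<in> {S \<in> [vertices]\<^bsup>j\<^esup>. indep S edges}"
    then have "S \<subseteq> vertices" "indep S edges" "S \<noteq> {}"
      using assms by (auto simp: nsets_def)
    then obtain c T F where
      "c \<in> C" "T \<subseteq> {..<q}" "F \<in> partial_sections c T" "S = face c T F"
      by (rule indep_imp_face)
    moreover from this have "T \<in> [{..<q}]\<^bsup>j\<^esup>"
      using S card_face finite_subset[of T "{..<q}"] by (auto simp: nsets_def)
    ultimately show "S \<in> ?face ` ?I"
      by force
  qed
  have "num_indep_sets vertices edges j = card ?I"
    unfolding num_indep_sets_def image[symmetric] by (rule card_image[OF inj])
  also have "\<dots> = (\<Sum>c\<in>C. \<Sum>T\<in>[{..<q}]\<^bsup>j\<^esup>. card (partial_sections c T))"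
    using fin_C fin_K unfolding partial_sections_def
    by (simp add: card_SigmaI finite_imp_finite_nsets finite_PiE)
  also have "\<dots> = (\<Sum>c\<in>C. \<Sum>T\<in>[{..<q}]\<^bsup>j\<^esup>. m ^ card {A \<in> K c. \<not> T \<subseteq> A})"
    using fin_K unfolding partial_sections_def by (intro sum.cong) (auto simp: card_PiE)
  finally show ?thesis .
qed

end

section \<open>Prescribed leading order of the counts\<close>

text \<open>A \<open>k\<close>-set cannot contain a larger \<open>T\<close>. If \<open>T\<close> has
  at most \<open>k\<close> elements, some \<open>k\<close>-set contains it, and this one missing set
  costs a factor \<open>m\<close> in the number of colourings.\<close>

lemma card_nsets_not_supset:
  assumes "T \<in> [{..<q}]\<^bsup>j\<^esup>"
  shows "k < j \<Longrightarrow> card {A \<in> [{..<q}]\<^bsup>k\<^esup>. \<not> T \<subseteq> A} = q choose k"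
    and "j \<le> k \<Longrightarrow> k \<le> q \<Longrightarrow> card {A \<in> [{..<q}]\<^bsup>k\<^esup>. \<not> T \<subseteq> A} \<le> (q choose k) - 1"
proof -
  have T: "T \<subseteq> {..<q}" "finite T" "card T = j"
    using assms by (auto simp: nsets_def)
  have card: "card ([{..<q}]\<^bsup>k\<^esup>) = q choose k"
    by simp
  show "card {A \<in> [{..<q}]\<^bsup>k\<^esup>. \<not> T \<subseteq> A} = q choose k" if "k < j"
  proof -
    have "\<not> T \<subseteq> A" if "A \<in> [{..<q}]\<^bsup>k\<^esup>" for A
      using that T \<open>k < j\<close> card_mono[of A T] by (auto simp: nsets_def)
    then have "{A \<in> [{..<q}]\<^bsup>k\<^esup>. \<not> T \<subseteq> A} = [{..<q}]\<^bsup>k\<^esup>"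
      by blast
    then show ?thesis
      using card by simp
  qed
  show "card {A \<in> [{..<q}]\<^bsup>k\<^esup>. \<not> T \<subseteq> A} \<le> (q choose k) - 1" if "j \<le> k" "k \<le> q"
  proof -
    have "\<exists>B. T \<subseteq> B \<and> B \<subseteq> {..<q} \<and> card B = k"
      using T that by (intro exists_subset_between) auto
    then obtain B where "T \<subseteq> B" "B \<subseteq> {..<q}" "card B = k"
      by blast
    then have B: "B \<in> [{..<q}]\<^bsup>k\<^esup>" "T \<subseteq> B"
      using finite_subset by (auto simp: nsets_def)
    have "card {A \<in> [{..<q}]\<^bsup>k\<^esup>. \<not> T \<subseteq> A} \<le> card ([{..<q}]\<^bsup>k\<^esup> - {B})"
      using B by (intro card_mono) (auto simp: finite_imp_finite_nsets)
    then show ?thesis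
      using B card by (simp add: finite_imp_finite_nsets)
  qed
qed

text \<open>In units of \<open>N\<close> the count is the integer \<open>(q choose j) * B j\<close>
  up to an error below one unit, so strict inequalities between these integers carry over to the
  counts.\<close>

lemma well_covered_with_prescribed_leading_order:
  fixes B :: "nat \<Rightarrow> nat"
  assumes "B 0 = 0" "B q > 0" and mono: "\<And>k. k < q \<Longrightarrow> B k \<le> B (Suc k)"
  obtains V :: "nat set" and E and N :: nat where
    "finite_simple_graph V E" "well_covered V E" "independence_number V E = q"
    "\<And>j. 0 < j \<Longrightarrow> j \<le> q \<Longrightarrow> (q choose j) * B j * N \<le> num_indep_sets V E j"
    "\<And>j. 0 < j \<Longrightarrow> j \<le> q \<Longrightarrow> num_indep_sets V E j < ((q choose j) * B j + 1) * N"
proof -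
  define b where "b k = B (Suc k) - B k" for k
  have B_sum: "(\<Sum>k<j. b k) = B j" if "j \<le> q" for j
    using that
  proof (induction j)
    case (Suc j)
    then show ?case
      using mono[of j] by (simp add: b_def)
  qed (simp add: assms(1))
  \<comment> \<open>Just large enough to exceed \<open>2 ^ q * B q\<close>, which bounds the total
    coefficient of the error terms.\<close>
  define m where "m = 2 ^ q * B q + 1"
  \<comment> \<open>A common upper bound of all \<open>q choose k\<close>, so that the subtraction
    in the exponent of \<open>a\<close> is never truncated.\<close>
  define L :: nat where "L = 2 ^ q"
  \<comment> \<open>The number of components with parameter \<open>k\<close>; the power of \<open>m\<close> makes up for the different
    numbers of colourings, so that each unit of \<open>b k\<close> contributes \<open>(q choose j) * m ^ L\<close>.\<close>
  define a where "a k = b k * m ^ (L - (q choose k))" for k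
  define C where "C = (SIGMA k:{..<q}. {..<a k})"
  define K where "K c = [{..<q}]\<^bsup>fst c\<^esup>" for c :: "nat \<times> nat"
  have "m > 0" "L > 0"
    by (simp_all add: m_def L_def)
  have choose_le: "q choose k \<le> L" for k
    unfolding L_def by (rule binomial_le_pow2)
  \<comment> \<open>This provides a component, as the locale requires \<open>C\<close> to be
    nonempty.\<close>
  have "\<exists>k<q. b k > 0"
  proof (rule ccontr)
    assume "\<not> ?thesis"
    then have "(\<Sum>k<q. b k) = 0"
      by simp
    then show False
      using B_sum[of q] assms(2) by simp
  qed
  then obtain k where "k < q" "a k > 0"
    using \<open>m > 0\<close> by (auto simp: a_def)
  then have "(k, 0) \<in> C"
    by (simp add: C_def)
  then have "C \<noteq> {}"
    by blast
  interpret gluing_graph q m C K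
    by unfold_locales
      (use \<open>C \<noteq> {}\<close> \<open>m > 0\<close> in \<open>auto simp: C_def K_def finite_imp_finite_nsets\<close>)
  define s where "s j k = (\<Sum>T\<in>[{..<q}]\<^bsup>j\<^esup>. m ^ card {A \<in> [{..<q}]\<^bsup>k\<^esup>. \<not> T \<subseteq> A})" for j k
  have num: "num_indep_sets vertices edges j = (\<Sum>k<q. a k * s j k)" if "j > 0" for j
  proof -
    have "num_indep_sets vertices edges j = (\<Sum>c\<in>C. s j (fst c))"
      unfolding num_indep_sets_eq[OF that] by (simp only: K_def s_def)
    also have "\<dots> = (\<Sum>k<q. \<Sum>n<a k. s j k)"
      unfolding C_def by (subst sum.Sigma) (auto simp: case_prod_beta)
    finally show ?thesis
      by simp
  qed
  have a_s_less: "a k * s j k = (q choose j) * b k * m ^ L" if "k < j" for j k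
  proof -
    have "s j k = (q choose j) * m ^ (q choose k)"
      unfolding s_def using card_nsets_not_supset(1)[OF _ that] by simp
    moreover have "m ^ (L - (q choose k)) * m ^ (q choose k) = m ^ L"
      using choose_le[of k] by (simp flip: power_add)
    ultimately show ?thesis
      unfolding a_def by (simp add: mult.assoc mult.left_commute)
  qed
  have a_s_ge: "a k * s j k \<le> (q choose j) * b k * m ^ (L - 1)" if "j \<le> k" "k < q" for j k
  proof -
    have "s j k \<le> (\<Sum>T\<in>[{..<q}]\<^bsup>j\<^esup>. m ^ ((q choose k) - 1))"
      unfolding s_def using card_nsets_not_supset(2) that \<open>m > 0\<close>
      by (intro sum_mono power_increasing) auto
    then have "s j k \<le> (q choose j) * m ^ ((q choose k) - 1)"
      by simp
    then have "a k * s j k \<le> a k * ((q choose j) * m ^ ((q choose k) - 1))"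
      by (rule mult_le_mono2)
    also have "\<dots> = (q choose j) * b k * (m ^ (L - (q choose k)) * m ^ ((q choose k) - 1))"
      by (simp add: a_def)
    also have "m ^ (L - (q choose k)) * m ^ ((q choose k) - 1) = m ^ (L - 1)"
      using choose_le[of k] that by (simp add: Suc_le_eq flip: power_add)
    finally show ?thesis .
  qed
  have split: "(\<Sum>k<q. f k) = (\<Sum>k<j. f k) + (\<Sum>k=j..<q. f k)" if "j \<le> q"
    for j and f :: "nat \<Rightarrow> nat"
    using that sum.atLeastLessThan_concat[of 0 j q f] by (simp add: lessThan_atLeast0)
  have main: "(\<Sum>k<j. a k * s j k) = (q choose j) * B j * m ^ L" if "j \<le> q" for j
  proof -
    have "(\<Sum>k<j. a k * s j k) = (\<Sum>k<j. (q choose j) * b k * m ^ L)"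
      using a_s_less by simp
    also have "\<dots> = (q choose j) * (\<Sum>k<j. b k) * m ^ L"
      by (simp add: sum_distrib_left sum_distrib_right)
    finally show ?thesis
      using B_sum[OF that] by simp
  qed
  \<comment> \<open>The terms with \<open>k \<ge> j\<close> carry at most the power
    \<open>m ^ (L - 1)\<close>, and \<open>m\<close> exceeds the sum of their coefficients.\<close>
  have tail: "(\<Sum>k=j..<q. a k * s j k) < m ^ L" if "j \<le> q" for j
  proof -
    have "(\<Sum>k=j..<q. a k * s j k) \<le> (\<Sum>k=j..<q. (q choose j) * b k * m ^ (L - 1))"
      using a_s_ge by (intro sum_mono) auto
    also have "\<dots> = (q choose j) * (\<Sum>k=j..<q. b k) * m ^ (L - 1)"
      by (simp add: sum_distrib_left sum_distrib_right)
    also have "\<dots> \<le> 2 ^ q * B q * m ^ (L - 1)"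
      using split[OF that, of b] B_sum[of q] binomial_le_pow2[of q j]
      by (intro mult_le_mono) auto
    also have "\<dots> < m * m ^ (L - 1)"
      using \<open>m > 0\<close> by (intro mult_strict_right_mono) (auto simp: m_def)
    also have "\<dots> = m ^ L"
      using power_minus_mult[OF \<open>L > 0\<close>, of m] by (simp only: mult.commute[of m])
    finally show ?thesis .
  qed
  obtain V :: "nat set" and E where G: "finite_simple_graph V E" "pure_indep V E q"
    and num_eq: "\<And>k. num_indep_sets V E k = num_indep_sets vertices edges k"
    using isomorphic_graph_on_nat[OF finite_simple_graph pure_indep] by blast
  have "num_indep_sets V E j = (q choose j) * B j * m ^ L + (\<Sum>k=j..<q. a k * s j k)"
    if "0 < j" "j \<le> q" for j
    using that num_eq num split main by simp
  moreover have "well_covered V E" "independence_number V E = q"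
    using G well_covered_if_pure independence_number_if_pure
    unfolding finite_simple_graph_def by blast+
  ultimately show thesis
    using that[of V E "m ^ L"] G(1) tail by simp
qed

section \<open>Monotone weights with nearly equal products\<close>

text \<open>This is the strict decrease of \<open>q choose j\<close> from the middle on, stated for
  \<open>fact q\<close> divided by it; the reason is \<open>q - j < Suc j\<close>.\<close>

lemma fact_mult_fact_strict_mono:
  assumes "q \<le> 2 * j" "j < q"
  shows "fact j * fact (q - j) < (fact (Suc j) * fact (q - Suc j) :: nat)"
proof -
  have "fact j * fact (q - j) = (q - j) * (fact j * fact (q - Suc j) :: nat)"
    using assms by (simp add: fact_reduce)
  also have "\<dots> < Suc j * (fact j * fact (q - Suc j))"
    using assms by (intro mult_strict_right_mono) auto
  finally show ?thesis
    by (simp add: algebra_simps)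
qed

text \<open>The products are levelled to \<open>fact q * M\<close>, and \<open>r\<close> then orders
  them. Monotonicity survives since \<open>u\<close> grows by at least 1 per step and a large
  \<open>M\<close> outweighs the change in \<open>r\<close>.\<close>

lemma exists_step_weights:
  fixes r :: "nat \<Rightarrow> nat"
  assumes "0 < h" "h \<le> q" "q \<le> 2 * h" and r: "\<And>j. h \<le> j \<Longrightarrow> j \<le> q \<Longrightarrow> r j \<le> q"
  obtains B :: "nat \<Rightarrow> nat" where "B 0 = 0" "B q > 0" "\<And>k. k < q \<Longrightarrow> B k \<le> B (Suc k)"
    "\<And>i j. \<lbrakk>h \<le> i; i \<le> q; h \<le> j; j \<le> q; r i < r j\<rbrakk> \<Longrightarrow>
       (q choose i) * B i < (q choose j) * B j"
proof -
  \<comment> \<open>\<open>u j = q! / (q choose j)\<close>, so that \<open>(q choose j) * B j = q! * (M + r j)\<close> for \<open>j \<ge> h\<close>.\<close>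
  define u :: "nat \<Rightarrow> nat" where "u j = fact j * fact (q - j)" for j
  \<comment> \<open>An upper bound of \<open>u k * r k\<close>, as \<open>u k\<close> divides
    \<open>fact q\<close>.\<close>
  define M where "M = fact q * q"
  \<comment> \<open>Only indices from \<open>h\<close> on are compared, so the smaller ones get 0,
    which includes \<open>B 0 = 0\<close>.\<close>
  define B where "B j = (if j < h then 0 else u j * (M + r j))" for j
  have choose_u: "(q choose j) * u j = fact q" if "j \<le> q" for j
    using binomial_fact_lemma[OF that] by (simp add: u_def mult_ac)
  have mono: "B k \<le> B (Suc k)" if "k < q" for k
  proof (cases "k < h")
    case False
    have "u k \<le> fact q"
      using choose_u[of k] that by (metis dvd_triv_right dvd_imp_le fact_gt_zero less_imp_le)
    then have "u k * r k \<le> M"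
      unfolding M_def using r[of k] that False by (intro mult_le_mono) auto
    then have "u k * (M + r k) \<le> Suc (u k) * M"
      by (simp add: algebra_simps)
    also have "\<dots> \<le> u (Suc k) * (M + r (Suc k))"
      using fact_mult_fact_strict_mono[of q k] that False assms
      by (intro mult_le_mono) (auto simp: u_def)
    finally show ?thesis
      using False by (simp add: B_def)
  qed (simp add: B_def)
  have "(q choose j) * B j = fact q * (M + r j)" if "h \<le> j" "j \<le> q" for j
    using that choose_u[of j] by (simp add: B_def mult.assoc[symmetric])
  moreover have "B 0 = 0" "B q > 0"
    using assms by (auto simp: B_def u_def M_def)
  ultimately show thesis
    using that[of B] mono by simp
qed

section \<open>Ordering the counts by the permutation\<close>

theorem theorem1p7:
  fixes q :: nat and \<pi> :: "nat \<Rightarrow> nat"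
  assumes "q > 0"
    and "\<pi> permutes {nat \<lceil>real q / 2\<rceil>..q}"
  shows "\<exists>(V :: nat set) (E :: nat set set).
           finite_simple_graph V E \<and> well_covered V E \<and> independence_number V E = q \<and>
           (\<forall>j \<in> {nat \<lceil>real q / 2\<rceil>..<q}.
              num_indep_sets V E (\<pi> j) < num_indep_sets V E (\<pi> (j + 1)))"
proof -
  define h where "h = nat \<lceil>real q / 2\<rceil>"
  \<comment> \<open>\<open>0 < h\<close> keeps all indices within reach of the count estimates, and
    \<open>q \<le> 2 * h\<close> puts them where the binomials decrease.\<close>
  have h: "0 < h" "h \<le> q" "q \<le> 2 * h"
    using assms(1) unfolding h_def by linarith+
  have perm: "\<pi> permutes {h..q}"
    using assms(2) by (simp add: h_def)
  \<comment> \<open>\<open>inv \<pi> j\<close> is the place of \<open>j\<close> in the prescribed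
    order and serves as its rank \<open>r j\<close>.\<close>
  have inv_le: "inv \<pi> j \<le> q" if "h \<le> j" "j \<le> q" for j
    using that permutes_in_image[OF permutes_inv[OF perm], of j] by simp
  obtain B :: "nat \<Rightarrow> nat" where B: "B 0 = 0" "B q > 0" "\<And>k. k < q \<Longrightarrow> B k \<le> B (Suc k)"
    and less: "\<And>i j. \<lbrakk>h \<le> i; i \<le> q; h \<le> j; j \<le> q; inv \<pi> i < inv \<pi> j\<rbrakk> \<Longrightarrow>
       (q choose i) * B i < (q choose j) * B j"
    using exists_step_weights[OF h, of "inv \<pi>"] inv_le by blast
  obtain V :: "nat set" and E and N :: nat where
    G: "finite_simple_graph V E" "well_covered V E" "independence_number V E = q"
    and lower: "\<And>j. 0 < j \<Longrightarrow> j \<le> q \<Longrightarrow> (q choose j) * B j * N \<le> num_indep_sets V E j"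
    and upper: "\<And>j. 0 < j \<Longrightarrow> j \<le> q \<Longrightarrow> num_indep_sets V E j < ((q choose j) * B j + 1) * N"
    using well_covered_with_prescribed_leading_order[OF B] by blast
  have "num_indep_sets V E (\<pi> j) < num_indep_sets V E (\<pi> (j + 1))" if j: "j \<in> {h..<q}" for j
  proof -
    have range: "h \<le> \<pi> j" "\<pi> j \<le> q" "h \<le> \<pi> (j + 1)" "\<pi> (j + 1) \<le> q"
      using j permutes_in_image[OF perm, of j] permutes_in_image[OF perm, of "j + 1"] by auto
    have "(q choose \<pi> j) * B (\<pi> j) < (q choose \<pi> (j + 1)) * B (\<pi> (j + 1))"
      using less range permutes_inverses(2)[OF perm] by simp
    \<comment> \<open>The integer gap of at least 1 absorbs the error, which is less than
      \<open>N\<close>.\<close>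
    then have "((q choose \<pi> j) * B (\<pi> j) + 1) * N \<le> (q choose \<pi> (j + 1)) * B (\<pi> (j + 1)) * N"
      by (intro mult_le_mono1) simp
    then show ?thesis
      using upper[of "\<pi> j"] lower[of "\<pi> (j + 1)"] range h(1) by linarith
  qed
  then show ?thesis
    using G unfolding h_def by blast
qed

end
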